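(* Let $\mathfrak{B}$ be a Boolean contact algebra satisfying the interpolation axiom (IA): $x\ll y\to\exists z\,(x\ll z\ll y)$, and the coherence axiom (C6): $x\notin\{\mathsf{0},\mathsf{1}\}\to x\mathrel{\mathsf{C}} -x$. Then every W-representative of $\mathfrak{B}$ of coinitiality $\omega$ is a G-representative.
   Context: A Boolean contact algebra is a Boolean algebra $\langle B,\cdot,+,-,\mathsf{0},\mathsf{1}\rangle$ with a relation $\mathsf{C}$ satisfying (C0) $\neg(\mathsf{0}\mathrel{\mathsf{C}} x)$; (C1) $x\leq y\wedge x\neq\mathsf{0}\to x\mathrel{\mathsf{C}} y$; (C2) symmetry; (C3) $x\leq y\to\forall z(z\mathrel{\mathsf{C}} x\to z\mathrel{\mathsf{C}} y)$; (C4) $x\mathrel{\mathsf{C}}(y+z)\to x\mathrel{\mathsf{C}} y\vee x\mathrel{\mathsf{C}} z$. $x\ll y$ iff $\neg(x\mathrel{\mathsf{C}} -y)$; $x\mathrel{\mathsf{O}} y$ iff $x\cdot y\neq\mathsf{0}$. For $X,Y\subseteq B$, $X\trianglelefteq Y$ means: for every $y\in Y$ there is $x\in X$ with $x\leq y$; $X,Y$ are coinitial if $X\trianglelefteq Y$ and $Y\trianglelefteq X$. A G-representative is a non-empty $Q\subseteq B$ with (r0) $\mathsf{0}\notin Q$; (r1) for all $u,v\in Q$: $u=v$ or $u\ll v$ or $v\ll u$; (r2) for every $u\in Q$ there is $v\in Q$ with $v\ll u$; (r3) for all $x,y$: if $u\mathrel{\mathsf{O}} x$ and $u\mathrel{\mathsf{O}}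 y$ for all $u\in Q$ then $x\mathrel{\mathsf{C}} y$. An abstractive set is $A\subseteq B$ with (r0), (r1) and (A): there is no non-zero $x\in B$ with $x\leq y$ for all $y\in A$. A W-representative is an abstractive set $A$ such that for every abstractive set $D$, $D\trianglelefteq A$ implies $A\trianglelefteq D$. The coinitiality of a chain $C$ (w.r.t. $\leq$) is the smallest cardinal $\kappa$ such that there is an antitone function $f\colon\kappa\to C$ with $f[\kappa]$ coinitial with $C$. *)

theory Defs
  imports Main
begin

text \<open>The ambient Boolean algebra is the type \<open>'a::boolean_algebra\<close>. As \<open>0 \<noteq> 1\<close> is not
  assumed by this class, the degenerate algebra is included.\<close>

locale boolean_contact_algebra =
  fixes C :: "'a::boolean_algebra \<Rightarrow> 'a \<Rightarrow> bool"
  assumes C0: "\<not> C bot x"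
    and C1: "x \<le> y \<Longrightarrow> x \<noteq> bot \<Longrightarrow> C x y"
    and C2: "C x y \<Longrightarrow> C y x"
    and C3: "x \<le> y \<Longrightarrow> C z x \<Longrightarrow> C z y"
    and C4: "C x (sup y z) \<Longrightarrow> C x y \<or> C x z"

definition well_inside :: "('a::boolean_algebra \<Rightarrow> 'a \<Rightarrow> bool) \<Rightarrow> 'a \<Rightarrow> 'a \<Rightarrow> bool" where
  "well_inside C x y \<longleftrightarrow> \<not> C x (- y)"

definition overlap :: "'a::boolean_algebra \<Rightarrow> 'a \<Rightarrow> bool" where
  "overlap x y \<longleftrightarrow> inf x y \<noteq> bot"

definition interpolation_axiom :: "('a::boolean_algebra \<Rightarrow> 'a \<Rightarrow> bool) \<Rightarrow> bool" where
  "interpolation_axiom C \<longleftrightarrow>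
    (\<forall>x y. well_inside C x y \<longrightarrow> (\<exists>z. well_inside C x z \<and> well_inside C z y))"

definition coherence_axiom :: "('a::boolean_algebra \<Rightarrow> 'a \<Rightarrow> bool) \<Rightarrow> bool" where
  "coherence_axiom C \<longleftrightarrow> (\<forall>x. x \<notin> {bot, top} \<longrightarrow> C x (- x))"

definition covers :: "'a::order set \<Rightarrow> 'a set \<Rightarrow> bool" where
  "covers X Y \<longleftrightarrow> (\<forall>y\<in>Y. \<exists>x\<in>X. x \<le> y)"

definition coinitial :: "'a::order set \<Rightarrow> 'a set \<Rightarrow> bool" where
  "coinitial X Y \<longleftrightarrow> covers X Y \<and> covers Y X"

definition r0 :: "'a::boolean_algebra set \<Rightarrow> bool" where
  "r0 Q \<longleftrightarrow> bot \<notin> Q"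

definition r1 :: "('a::boolean_algebra \<Rightarrow> 'a \<Rightarrow> bool) \<Rightarrow> 'a set \<Rightarrow> bool" where
  "r1 C Q \<longleftrightarrow> (\<forall>u\<in>Q. \<forall>v\<in>Q. u = v \<or> well_inside C u v \<or> well_inside C v u)"

definition r2 :: "('a::boolean_algebra \<Rightarrow> 'a \<Rightarrow> bool) \<Rightarrow> 'a set \<Rightarrow> bool" where
  "r2 C Q \<longleftrightarrow> (\<forall>u\<in>Q. \<exists>v\<in>Q. well_inside C v u)"

definition r3 :: "('a::boolean_algebra \<Rightarrow> 'a \<Rightarrow> bool) \<Rightarrow> 'a set \<Rightarrow> bool" where
  "r3 C Q \<longleftrightarrow> (\<forall>x y. (\<forall>u\<in>Q. overlap u x \<and> overlap u y) \<longrightarrow> C x y)"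

definition G_representative :: "('a::boolean_algebra \<Rightarrow> 'a \<Rightarrow> bool) \<Rightarrow> 'a set \<Rightarrow> bool" where
  "G_representative C Q \<longleftrightarrow> Q \<noteq> {} \<and> r0 Q \<and> r1 C Q \<and> r2 C Q \<and> r3 C Q"

definition abstractive_set :: "('a::boolean_algebra \<Rightarrow> 'a \<Rightarrow> bool) \<Rightarrow> 'a set \<Rightarrow> bool" where
  "abstractive_set C A \<longleftrightarrow> r0 A \<and> r1 C A \<and> \<not> (\<exists>x. x \<noteq> bot \<and> (\<forall>y\<in>A. x \<le> y))"

definition W_representative :: "('a::boolean_algebra \<Rightarrow> 'a \<Rightarrow> bool) \<Rightarrow> 'a set \<Rightarrow> bool" where
  "W_representative C A \<longleftrightarrow>
    abstractive_set C A \<and> (\<forall>D. abstractive_set C D \<longrightarrow> covers D A \<longrightarrow> covers A D)"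

text \<open>A cardinal \<open>\<kappa>\<close> is represented, as in the library, by a well-order on \<open>Field \<kappa>\<close> satisfying
  \<^const>\<open>Card_order\<close>; \<open>\<omega>\<close> is \<^const>\<open>natLeq\<close>.\<close>

definition coinitial_sequence :: "'k rel \<Rightarrow> ('k \<Rightarrow> 'a::order) \<Rightarrow> 'a set \<Rightarrow> bool" where
  "coinitial_sequence \<kappa> f X \<longleftrightarrow>
    f ` Field \<kappa> \<subseteq> X \<and>
    monotone_on (Field \<kappa>) (\<lambda>\<alpha> \<beta>. (\<alpha>, \<beta>) \<in> \<kappa>) (\<ge>) f \<and>
    coinitial (f ` Field \<kappa>) X"

text \<open>In the minimality clause it suffices to let \<open>\<kappa>'\<close> range over cardinals on the type \<open>'k\<close>
  of \<open>\<kappa>\<close>: every cardinal below \<open>\<kappa>\<close> is isomorphic to one on a subset of \<open>Field \<kappa>\<close>.\<close>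

definition has_coinitiality :: "'a::order set \<Rightarrow> 'k rel \<Rightarrow> bool" where
  "has_coinitiality X \<kappa> \<longleftrightarrow>
    Card_order \<kappa> \<and> (\<exists>f. coinitial_sequence \<kappa> f X) \<and>
    (\<forall>\<kappa>' :: 'k rel. Card_order \<kappa>' \<longrightarrow> (\<exists>f. coinitial_sequence \<kappa>' f X) \<longrightarrow> (\<kappa>, \<kappa>') \<in> ordLeq)"

end

theory Submission imports Defs begin

text \<open>A non-empty abstractive set is a chain of non-zero elements without a least element, which
  gives (r2). For (r3), suppose that \<open>x\<close> and \<open>y\<close> overlap every member of \<open>A\<close> although \<open>x \<lless> -y\<close>.
  Interpolation yields \<open>x \<lless> \<dots> \<lless> z\<^sub>1 \<lless> z\<^sub>0 \<lless> -y\<close>, and countable coinitiality yields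
  \<open>\<dots> \<lless> a\<^sub>1 \<lless> a\<^sub>0\<close> coinitial with \<open>A\<close>. The products \<open>a\<^sub>n \<cdot> z\<^sub>n\<close> form an abstractive set covering \<open>A\<close>,
  so being a W-representative forces some member of \<open>A\<close> below \<open>a\<^sub>0 \<cdot> z\<^sub>0 \<le> -y\<close>, although it
  overlaps \<open>y\<close>.\<close>

context boolean_contact_algebra
begin

text \<open>A non-zero \<open>inf x (- y)\<close> is in contact with \<open>- y\<close> by
  \<open>C1\<close>, and enlarging its other side to \<open>x\<close> gives
  \<open>C x (- y)\<close>.\<close>

lemma well_inside_imp_le:
  assumes "well_inside C x y"
  shows "x \<le> y"
proof -
  have "inf x (- y) = bot"
  proof (rule ccontr)
    assume "inf x (- y) \<noteq> bot"
    then have "C x (- y)"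
      by (meson C1 C2 C3 inf_le1 inf_le2)
    with assms show False
      by (simp add: well_inside_def)
  qed
  then show ?thesis
    by (simp add: inf_shunt)
qed

lemma well_inside_mono:
  assumes "x' \<le> x" "well_inside C x y" "y \<le> y'"
  shows "well_inside C x' y'"
  using assms unfolding well_inside_def by (meson C2 C3 compl_mono)

lemma well_inside_trans:
  "well_inside C x y \<Longrightarrow> well_inside C y z \<Longrightarrow> well_inside C x z"
  using well_inside_mono well_inside_imp_le by blast

text \<open>Since \<open>- inf y v = sup (- y) (- v)\<close>, \<open>C4\<close> reduces the claim to
  the two factors.\<close>

lemma well_inside_inf:
  assumes "well_inside C x y" "well_inside C u v"
  shows "well_inside C (inf x u) (inf y v)"
  using well_inside_mono[OF _ assms(1) order_refl, of "inf x u"]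
    well_inside_mono[OF _ assms(2) order_refl, of "inf x u"] C4
  unfolding well_inside_def by fastforce

lemma r1_range:
  fixes s :: "nat \<Rightarrow> 'a"
  assumes "\<And>n. well_inside C (s (Suc n)) (s n)"
  shows "r1 C (range s)"
proof -
  have "well_inside C (s n) (s m)" if "m < n" for m n
    using that by (induction rule: less_Suc_induct) (auto intro: assms well_inside_trans)
  then show ?thesis
    unfolding r1_def by (metis imageE nat_neq_iff)
qed

lemma r1_le_cases:
  assumes "r1 C A" "u \<in> A" "v \<in> A"
  shows "u \<le> v \<or> v \<le> u"
  using assms unfolding r1_def by (metis order_refl well_inside_imp_le)

lemma abstractive_set_imp_r2:
  assumes "abstractive_set C A"
  shows "r2 C A"
  unfolding r2_def
proof
  fix u assume "u \<in> A"
  \<comment> \<open>By \<open>r0\<close>, \<open>u\<close> is non-zero, so it cannot be a lower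
    bound of \<open>A\<close>.\<close>
  with assms obtain v where "v \<in> A" "\<not> u \<le> v"
    unfolding abstractive_set_def r0_def by metis
  with \<open>u \<in> A\<close> assms have "well_inside C v u"
    unfolding abstractive_set_def r1_def by (metis order_refl well_inside_imp_le)
  with \<open>v \<in> A\<close> show "\<exists>v\<in>A. well_inside C v u" ..
qed

lemma interpolating_sequence:
  assumes "interpolation_axiom C" "well_inside C x y"
  obtains z :: "nat \<Rightarrow> 'a"
  where "\<And>n. well_inside C x (z n)" "\<And>n. well_inside C (z (Suc n)) (z n)" "z 0 \<le> y"
proof -
  obtain z :: "nat \<Rightarrow> 'a" where
    "\<And>n. well_inside C x (z n) \<and> z n \<le> y" "\<And>n. well_inside C (z (Suc n)) (z n)"
    using dependent_nat_choice[of "\<lambda>_ w. well_inside C x w \<and> w \<le> y"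
        "\<lambda>_ w w'. well_inside C w' w"] assms
    unfolding interpolation_axiom_def by (metis order_refl order_trans well_inside_imp_le)
  then show thesis
    using that by blast
qed

lemma decreasing_coinitial_sequence:
  fixes f :: "nat \<Rightarrow> 'a"
  assumes "abstractive_set C A" "range f \<subseteq> A"
  obtains a :: "nat \<Rightarrow> 'a"
  where "\<And>n. a n \<in> A" "\<And>n. a n \<le> f n" "\<And>n. well_inside C (a (Suc n)) (a n)"
proof -
  have step: "\<exists>v. (v \<in> A \<and> v \<le> f (Suc n)) \<and> well_inside C v u"
    if u: "u \<in> A \<and> u \<le> f n" for u n
  proof -
    obtain v where v: "v \<in> A" "well_inside C v u"
      using u abstractive_set_imp_r2[OF assms(1)] unfolding r2_def by blast
    have "f (Suc n) \<in> A"
      using assms(2) by blast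
    moreover have "r1 C A"
      using assms(1) unfolding abstractive_set_def by blast
    \<comment> \<open>The witness is the smaller of \<open>v\<close> and \<open>f (Suc n)\<close>,
      which are comparable in the chain \<open>A\<close>.\<close>
    ultimately show ?thesis
      using v r1_le_cases well_inside_mono[OF _ v(2) order_refl] by blast
  qed
  have "f 0 \<in> A"
    using assms(2) by blast
  then obtain a :: "nat \<Rightarrow> 'a" where
    "\<And>n. a n \<in> A \<and> a n \<le> f n" "\<And>n. well_inside C (a (Suc n)) (a n)"
    using dependent_nat_choice[of "\<lambda>n u. u \<in> A \<and> u \<le> f n" "\<lambda>_ u v. well_inside C v u"] step
    by (metis order_refl)
  then show thesis
    using that by blast
qed

lemma W_representative_imp_r3:
  fixes f :: "nat \<Rightarrow> 'a"
  assumes IA: "interpolation_axiom C" and W: "W_representative C A"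
    and f: "range f \<subseteq> A" "covers (range f) A"
  shows "r3 C A"
  unfolding r3_def
proof (intro allI impI, rule ccontr)
  fix x y assume ov: "\<forall>u\<in>A. overlap u x \<and> overlap u y" and "\<not> C x y"
  then have "well_inside C x (- y)"
    by (simp add: well_inside_def)
  with IA obtain z :: "nat \<Rightarrow> 'a" where z: "\<And>n. well_inside C x (z n)"
    "\<And>n. well_inside C (z (Suc n)) (z n)" "z 0 \<le> - y"
    using interpolating_sequence by blast
  have A: "abstractive_set C A"
    using W unfolding W_representative_def by blast
  obtain a :: "nat \<Rightarrow> 'a" where a: "\<And>n. a n \<in> A" "\<And>n. a n \<le> f n"
    "\<And>n. well_inside C (a (Suc n)) (a n)"
    using decreasing_coinitial_sequence[OF A f(1)] by blast
  define s where "s n = inf (a n) (z n)" for n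
  have "r1 C (range s)"
    unfolding s_def using a(3) z(2) by (intro r1_range well_inside_inf)
  moreover have "s n \<noteq> bot" for n
  proof -
    \<comment> \<open>The overlap with \<open>x\<close> keeps the products non-zero, because
      \<open>x\<close> lies below every \<open>z n\<close>.\<close>
    have "inf (a n) x \<noteq> bot"
      using ov a(1) by (simp add: overlap_def)
    moreover have "inf (a n) x \<le> s n"
      unfolding s_def using well_inside_imp_le[OF z(1)] by (intro inf_mono) auto
    ultimately show ?thesis
      by (metis bot_unique)
  qed
  then have "r0 (range s)"
    unfolding r0_def by (metis imageE)
  moreover have cov: "covers (range s) A"
    unfolding covers_def
  proof
    fix b assume "b \<in> A"
    then obtain n where "f n \<le> b"
      using f(2) unfolding covers_def by blast
    then have "s n \<le> b"
      unfolding s_def using a(2)[of n] by (meson inf.coboundedI1 order_trans)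
    then show "\<exists>d\<in>range s. d \<le> b"
      by blast
  qed
  \<comment> \<open>As \<open>range s\<close> covers \<open>A\<close>, any lower bound of
    \<open>range s\<close> is also one of \<open>A\<close>.\<close>
  moreover have "\<not> (\<exists>w. w \<noteq> bot \<and> (\<forall>d\<in>range s. w \<le> d))"
    using A cov unfolding abstractive_set_def covers_def by (meson order_trans)
  \<comment> \<open>Here the minimality of \<open>A\<close> among abstractive sets is applied to
    \<open>D = range s\<close>.\<close>
  ultimately have "covers A (range s)"
    using W unfolding W_representative_def abstractive_set_def by blast
  then obtain b where "b \<in> A" "b \<le> s 0"
    unfolding covers_def by blast
  then have "b \<le> - y"
    using z(3) unfolding s_def by (meson inf.boundedE order_trans)
  then have "inf b y = bot"
    by (simp add: inf_shunt)
  with ov \<open>b \<in> A\<close> show False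
    by (simp add: overlap_def)
qed

end

theorem theorem5p3:
  fixes C :: "'a::boolean_algebra \<Rightarrow> 'a \<Rightarrow> bool" and A :: "'a set"
  assumes "boolean_contact_algebra C"
    and "interpolation_axiom C"
    and "coherence_axiom C"
    and "W_representative C A"
    and "has_coinitiality A natLeq"
  shows "G_representative C A"
proof -
  interpret boolean_contact_algebra C
    by fact
  obtain f :: "nat \<Rightarrow> 'a" where f: "range f \<subseteq> A" "covers (range f) A"
    using assms(5)
    unfolding has_coinitiality_def coinitial_sequence_def coinitial_def Field_natLeq by blast
  have A: "abstractive_set C A"
    using assms(4) unfolding W_representative_def by blast
  \<comment> \<open>Non-emptiness of \<open>A\<close> comes from
    \<open>range f \<subseteq> A\<close>; in the degenerate algebra the empty set is abstractive
    too.\<close>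
  show ?thesis
    unfolding G_representative_def
    using f A abstractive_set_imp_r2[OF A] W_representative_imp_r3[OF assms(2,4) f]
    unfolding abstractive_set_def by blast
qed

end
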